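(* Let $n\ge2$, let $\gamma\in\mathcal{M}_n(\mathbb{R})$ have central affine curvature $u$, and let $\xi_0,\ldots,\xi_{n-1}\in C^\infty(\mathbb{R},\mathbb{R})$. The vector field $\sum_{i=0}^{n-1}\xi_i\gamma_x^{(i)}$ is tangent to $\mathcal{M}_n(\mathbb{R})$ at $\gamma$ if and only if $\xi_0=\phi_n(u,\xi_1,\ldots,\xi_{n-1})$.
   Context: $\mathcal{M}_n(\mathbb{R})$ is the set of smooth $\gamma:\mathbb{R}\to\mathbb{R}^n\setminus\{0\}$ with $\det(\gamma,\gamma_x,\ldots,\gamma_x^{(n-1)})=1$. For such $\gamma$, $\gamma_x^{(n)}=u_1\gamma+\cdots+u_{n-1}\gamma_x^{(n-2)}$ and $u=\sum_{i=1}^{n-1}u_ie_{in}$ is the central affine curvature. A smooth $X:\mathbb{R}\to\mathbb{R}^n$ is tangent to $\mathcal{M}_n(\mathbb{R})$ at $\gamma$ iff $\sum_{i=0}^{n-1}\det(\gamma,\ldots,\gamma_x^{(i-1)},X_x^{(i)},\gamma_x^{(i+1)},\ldots,\gamma_x^{(n-1)})=0$. A differential polynomial in given functions is a polynomial in them and their $x$-derivatives. Let $b=\sum_{i=1}^{n-1}e_{i+1,i}$ and $V_n=\bigoplus_{i=1}^{n-1}\mathbb{R}e_{in}$. $\phi_n$ denotes the differential polynomial (depending only on $n$) such that $C_{11}=\phi_n(u,C_{21},\ldots,C_{n1})$ for every smooth $u:\mathbb{R}\to V_n$ and every smooth $C=(C_{ij}):\mathbb{R}\to sl(n,\mathbb{R})$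 with $C_x+[b+u,C]\in V_n$; such a $\phi_n$ exists. *)

theory Defs
  imports
    "HOL-Analysis.Derivative"
    "HOL-Library.Poly_Mapping"
    "Jordan_Normal_Form.Determinant"
begin

text \<open>
  Vectors and matrices of size \<open>n\<close> are those of \<open>Jordan_Normal_Form\<close>, so indices start at 0:
  the matrix entry written \<open>A\<^sub>i\<^sub>j\<close> on paper is \<open>A $$ (i - 1, j - 1)\<close> here. These types
  carry no topology; smoothness and \<open>x\<close>-derivatives are taken entrywise.
\<close>

definition smooth_fun :: "(real \<Rightarrow> real) \<Rightarrow> bool" where
  "smooth_fun f \<longleftrightarrow> (\<forall>k x. (deriv ^^ k) f differentiable (at x))"

definition smooth_curve :: "nat \<Rightarrow> (real \<Rightarrow> real vec) \<Rightarrow> bool" where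
  "smooth_curve n X \<longleftrightarrow>
     (\<forall>x. X x \<in> carrier_vec n) \<and> (\<forall>i<n. smooth_fun (\<lambda>x. X x $ i))"

definition curve_deriv :: "nat \<Rightarrow> nat \<Rightarrow> (real \<Rightarrow> real vec) \<Rightarrow> real \<Rightarrow> real vec" where
  "curve_deriv n k X x = vec n (\<lambda>i. (deriv ^^ k) (\<lambda>t. X t $ i) x)"

definition smooth_mat :: "nat \<Rightarrow> (real \<Rightarrow> real mat) \<Rightarrow> bool" where
  "smooth_mat n A \<longleftrightarrow>
     (\<forall>x. A x \<in> carrier_mat n n) \<and> (\<forall>i<n. \<forall>j<n. smooth_fun (\<lambda>x. A x $$ (i, j)))"

definition mat_deriv :: "nat \<Rightarrow> (real \<Rightarrow> real mat) \<Rightarrow> real \<Rightarrow> real mat" where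
  "mat_deriv n A x = mat n n (\<lambda>(i, j). deriv (\<lambda>t. A t $$ (i, j)) x)"


subsection \<open>Central affine curves\<close>

definition central_affine_curves :: "nat \<Rightarrow> (real \<Rightarrow> real vec) set" where
  "central_affine_curves n = {\<gamma>. smooth_curve n \<gamma> \<and> (\<forall>x. \<gamma> x \<noteq> 0\<^sub>v n) \<and>
     (\<forall>x. det (mat_of_cols n (map (\<lambda>j. curve_deriv n j \<gamma> x) [0..<n])) = 1)}"

definition V_space :: "nat \<Rightarrow> real mat set" where
  "V_space n = {mat n n (\<lambda>(i, j). if i < n - 1 \<and> j = n - 1 then v i else 0) | v. True}"

text \<open>
  The curvature is determined by \<open>\<gamma>\<close>, because the derivatives of \<open>\<gamma>\<close> of order \<open>0, \<dots>, n - 1\<close>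
  form a basis at every point.
\<close>

definition central_affine_curvature ::
    "nat \<Rightarrow> (real \<Rightarrow> real vec) \<Rightarrow> (real \<Rightarrow> real mat) \<Rightarrow> bool" where
  "central_affine_curvature n \<gamma> u \<longleftrightarrow> (\<forall>x. u x \<in> V_space n \<and>
     curve_deriv n n \<gamma> x =
       vec n (\<lambda>k. \<Sum>i=1..n-1. u x $$ (i - 1, n - 1) * curve_deriv n (i - 1) \<gamma> x $ k))"

definition tangent_at :: "nat \<Rightarrow> (real \<Rightarrow> real vec) \<Rightarrow> (real \<Rightarrow> real vec) \<Rightarrow> bool" where
  "tangent_at n \<gamma> X \<longleftrightarrow> smooth_curve n X \<and>
     (\<forall>x. (\<Sum>i<n. det (mat_of_cols n
        (map (\<lambda>j. if j = i then curve_deriv n i X x else curve_deriv n j \<gamma> x) [0..<n]))) = 0)"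


subsection \<open>Differential polynomials\<close>

text \<open>
  Polynomials over the reals in the indeterminates \<open>(v, k)\<close>, standing for the \<open>k\<close>-th
  derivative of the function named \<open>v\<close>.
\<close>

type_synonym 'v diff_poly = "(('v \<times> nat) \<Rightarrow>\<^sub>0 nat) \<Rightarrow>\<^sub>0 real"

definition diff_poly_funs :: "'v diff_poly \<Rightarrow> 'v set" where
  "diff_poly_funs P = (\<Union>m\<in>Poly_Mapping.keys P. fst ` Poly_Mapping.keys m)"

definition diff_poly_eval :: "'v diff_poly \<Rightarrow> ('v \<Rightarrow> real \<Rightarrow> real) \<Rightarrow> real \<Rightarrow> real" where
  "diff_poly_eval P f x =
     (\<Sum>m\<in>Poly_Mapping.keys P. Poly_Mapping.lookup P m *
        (\<Prod>(v, k)\<in>Poly_Mapping.keys m. ((deriv ^^ k) (f v) x) ^ Poly_Mapping.lookup m (v, k)))"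

text \<open>
  The arguments \<open>(u, \<xi>\<^sub>1, \<dots>, \<xi>\<^sub>n\<^sub>-\<^sub>1)\<close>: \<open>Inl i\<close> names the function \<open>u\<^sub>i\<close> and \<open>Inr i\<close> names
  \<open>\<xi>\<^sub>i\<close>, for \<open>1 \<le> i \<le> n - 1\<close>; in the defining property of \<open>\<phi>\<^sub>n\<close> the latter is the entry of
  the matrix \<open>C\<close> in row \<open>i + 1\<close> and column 1 (counted from 1).
\<close>

definition phi_args ::
    "nat \<Rightarrow> (real \<Rightarrow> real mat) \<Rightarrow> (nat \<Rightarrow> real \<Rightarrow> real) \<Rightarrow> nat + nat \<Rightarrow> real \<Rightarrow> real" where
  "phi_args n u \<xi> = case_sum (\<lambda>i x. u x $$ (i - 1, n - 1)) \<xi>"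

definition b_mat :: "nat \<Rightarrow> real mat" where
  "b_mat n = mat n n (\<lambda>(i, j). if i = j + 1 then 1 else 0)"

definition sl_mat :: "nat \<Rightarrow> real mat set" where
  "sl_mat n = {A \<in> carrier_mat n n. (\<Sum>i<n. A $$ (i, i)) = 0}"

definition is_phi :: "nat \<Rightarrow> (nat + nat) diff_poly \<Rightarrow> bool" where
  "is_phi n P \<longleftrightarrow> diff_poly_funs P \<subseteq> Inl ` {1..n-1} \<union> Inr ` {1..n-1} \<and>
     (\<forall>u C. smooth_mat n u \<longrightarrow> (\<forall>x. u x \<in> V_space n) \<longrightarrow>
            smooth_mat n C \<longrightarrow> (\<forall>x. C x \<in> sl_mat n) \<longrightarrow>
            (\<forall>x. mat_deriv n C x + ((b_mat n + u x) * C x - C x * (b_mat n + u x)) \<in> V_space n) \<longrightarrow>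
            (\<lambda>x. C x $$ (0, 0)) = diff_poly_eval P (phi_args n u (\<lambda>i x. C x $$ (i, 0))))"

text \<open>
  For \<open>n \<ge> 2\<close> such a polynomial exists, and it is unique, because \<open>u\<close> and the entries of the
  first column of \<open>C\<close> below the diagonal can be prescribed arbitrarily.
\<close>

definition phi :: "nat \<Rightarrow> (nat + nat) diff_poly" where
  "phi n = (SOME P. is_phi n P)"

end

theory Submission
  imports Defs
begin

text \<open>
  In the frame \<open>g = (\<gamma>, \<gamma>\<^sub>x, \<dots>)\<close>, which satisfies \<open>g\<^sub>x = g (b + u)\<close>, the derivatives of
  \<open>X = \<Sum>\<^sub>i \<xi>\<^sub>i \<gamma>\<^sub>x\<^sup>(\<^sup>i\<^sup>)\<close> have coordinate vectors given by \<open>C\<^sub>0 = \<xi>\<close> and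
  \<open>C\<^sub>k\<^sub>+\<^sub>1 = (C\<^sub>k)\<^sub>x + (b + u) C\<^sub>k\<close>. Since \<open>det g = 1\<close>, Cramer's rule turns tangency into the vanishing
  of the trace of the matrix \<open>C\<close> with columns \<open>C\<^sub>0, \<dots>, C\<^sub>n\<^sub>-\<^sub>1\<close>. The same recursion says that
  \<open>C\<^sub>x + [b + u, C]\<close> vanishes outside its last column, so the matrices in the definition of
  \<open>\<phi>\<^sub>n\<close> are exactly those of trace 0 that arise in this way. The trace equals \<open>n \<xi>\<^sub>0\<close> plus a
  differential polynomial in \<open>u, \<xi>\<^sub>1, \<dots>, \<xi>\<^sub>n\<^sub>-\<^sub>1\<close>; this yields \<open>\<phi>\<^sub>n\<close> and shows that
  the trace vanishes only for \<open>\<xi>\<^sub>0 = \<phi>\<^sub>n(u, \<xi>\<^sub>1, \<dots>, \<xi>\<^sub>n\<^sub>-\<^sub>1)\<close>.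
\<close>

section \<open>Smooth functions\<close>

lemma smooth_fun_unfold:
  "smooth_fun f \<longleftrightarrow> (\<forall>x. f differentiable (at x)) \<and> smooth_fun (deriv f)"
proof -
  have "(\<forall>k x. (deriv ^^ k) f differentiable (at x)) \<longleftrightarrow>
    (\<forall>x. (deriv ^^ 0) f differentiable (at x)) \<and>
    (\<forall>k x. (deriv ^^ Suc k) f differentiable (at x))"
    by (metis not0_implies_Suc)
  then show ?thesis
    by (simp add: smooth_fun_def funpow_swap1)
qed

lemma smooth_fun_deriv: "smooth_fun f \<Longrightarrow> smooth_fun (deriv f)"
  using smooth_fun_unfold by blast

lemma smooth_fun_higher_deriv: "smooth_fun f \<Longrightarrow> smooth_fun ((deriv ^^ k) f)"
  by (induction k) (auto intro: smooth_fun_deriv)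

lemma smooth_fun_DERIV: "smooth_fun f \<Longrightarrow> (f has_real_derivative deriv f x) (at x)"
  using smooth_fun_unfold DERIV_deriv_iff_real_differentiable by blast

text \<open>A class of differentiable functions closed under \<open>deriv\<close> contains all
  iterated derivatives of its members, so one such class around \<open>f\<close> suffices.\<close>

lemma smooth_fun_coinduct:
  assumes "f \<in> A"
    and "\<And>g x. g \<in> A \<Longrightarrow> g differentiable (at x)"
    and "\<And>g. g \<in> A \<Longrightarrow> deriv g \<in> A"
  shows "smooth_fun f"
proof -
  have "(deriv ^^ k) f \<in> A" for k
    by (induction k) (auto intro: assms)
  then show ?thesis
    unfolding smooth_fun_def using assms(2) by blast
qed

text \<open>The product rule turns a product into a sum of products; this class absorbs both and can
  therefore serve as the invariant in \<open>smooth_fun_coinduct\<close>.\<close>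

inductive_set smooth_algebra :: "(real \<Rightarrow> real) set" where
  base: "smooth_fun f \<Longrightarrow> f \<in> smooth_algebra"
| const: "(\<lambda>x. c) \<in> smooth_algebra"
| add: "f \<in> smooth_algebra \<Longrightarrow> g \<in> smooth_algebra \<Longrightarrow> (\<lambda>x. f x + g x) \<in> smooth_algebra"
| mult: "f \<in> smooth_algebra \<Longrightarrow> g \<in> smooth_algebra \<Longrightarrow> (\<lambda>x. f x * g x) \<in> smooth_algebra"

lemma smooth_algebra_DERIV:
  "f \<in> smooth_algebra \<Longrightarrow>
    \<exists>f'\<in>smooth_algebra. \<forall>x. (f has_real_derivative f' x) (at x)"
proof (induction rule: smooth_algebra.induct)
  case (base f)
  then show ?case
    using smooth_fun_DERIV smooth_fun_deriv smooth_algebra.base by blast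
next
  case (const c)
  then show ?case
    by (intro bexI[of _ "\<lambda>x. 0"]) (auto intro: smooth_algebra.const)
next
  case (add f g)
  then obtain f' g' where "f' \<in> smooth_algebra" "g' \<in> smooth_algebra"
    "\<And>x. (f has_real_derivative f' x) (at x)" "\<And>x. (g has_real_derivative g' x) (at x)"
    by blast
  then show ?case
    by (intro bexI[of _ "\<lambda>x. f' x + g' x"] allI DERIV_add smooth_algebra.add)
next
  case (mult f g)
  then obtain f' g' where "f' \<in> smooth_algebra" "g' \<in> smooth_algebra"
    "\<And>x. (f has_real_derivative f' x) (at x)" "\<And>x. (g has_real_derivative g' x) (at x)"
    by blast
  with mult.hyps show ?case
    by (intro bexI[of _ "\<lambda>x. f' x * g x + g' x * f x"] allI DERIV_mult
        smooth_algebra.add smooth_algebra.mult)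
qed

lemma smooth_algebra_smooth: "f \<in> smooth_algebra \<Longrightarrow> smooth_fun f"
proof (erule smooth_fun_coinduct)
  fix g x
  assume "g \<in> smooth_algebra"
  then obtain g' where g': "g' \<in> smooth_algebra" "\<And>x. (g has_real_derivative g' x) (at x)"
    using smooth_algebra_DERIV by blast
  then show "g differentiable (at x)"
    using real_differentiable_def by blast
  have "deriv g = g'"
    using g'(2) DERIV_imp_deriv by blast
  then show "deriv g \<in> smooth_algebra"
    using g'(1) by simp
qed

lemma smooth_fun_const [simp]: "smooth_fun (\<lambda>x. c)"
  by (rule smooth_algebra_smooth[OF smooth_algebra.const])

lemma smooth_fun_add: "smooth_fun f \<Longrightarrow> smooth_fun g \<Longrightarrow> smooth_fun (\<lambda>x. f x + g x)"
  by (rule smooth_algebra_smooth[OF smooth_algebra.add[OF smooth_algebra.base smooth_algebra.base]])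

lemma smooth_fun_mult: "smooth_fun f \<Longrightarrow> smooth_fun g \<Longrightarrow> smooth_fun (\<lambda>x. f x * g x)"
  by (rule smooth_algebra_smooth[OF smooth_algebra.mult[OF smooth_algebra.base smooth_algebra.base]])

lemma smooth_fun_sum:
  "(\<And>i. i \<in> I \<Longrightarrow> smooth_fun (f i)) \<Longrightarrow> smooth_fun (\<lambda>x. \<Sum>i\<in>I. f i x)"
  by (induction I rule: infinite_finite_induct) (simp_all add: smooth_fun_add)

lemma smooth_fun_prod:
  "(\<And>i. i \<in> I \<Longrightarrow> smooth_fun (f i)) \<Longrightarrow> smooth_fun (\<lambda>x. \<Prod>i\<in>I. f i x)"
  by (induction I rule: infinite_finite_induct) (simp_all add: smooth_fun_mult)

lemma smooth_fun_det:
  assumes "\<And>x. A x \<in> carrier_mat n n"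
    and "\<And>i j. i < n \<Longrightarrow> j < n \<Longrightarrow> smooth_fun (\<lambda>x. A x $$ (i, j))"
  shows "smooth_fun (\<lambda>x. det (A x))"
  unfolding det_def'[OF assms(1)]
  by (intro smooth_fun_sum smooth_fun_mult smooth_fun_prod smooth_fun_const assms(2))
    (auto simp: permutes_in_image)

section \<open>Evaluation of differential polynomials\<close>

definition jet_monom :: "('v \<Rightarrow> real \<Rightarrow> real) \<Rightarrow> real \<Rightarrow> ('v \<times> nat \<Rightarrow>\<^sub>0 nat) \<Rightarrow> real" where
  "jet_monom f x m =
    (\<Prod>(v, k)\<in>Poly_Mapping.keys m. ((deriv ^^ k) (f v) x) ^ Poly_Mapping.lookup m (v, k))"

lemma diff_poly_eval_jet_monom:
  "diff_poly_eval P f x =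
    (\<Sum>m\<in>Poly_Mapping.keys P. Poly_Mapping.lookup P m * jet_monom f x m)"
  by (simp add: diff_poly_eval_def jet_monom_def)

text \<open>Indeterminates outside \<open>m\<close> have exponent 0 and contribute a factor 1, so
  several monomials can be evaluated over one index set.\<close>

lemma jet_monom_superset:
  assumes "finite K" "Poly_Mapping.keys m \<subseteq> K"
  shows "jet_monom f x m =
    (\<Prod>(v, k)\<in>K. ((deriv ^^ k) (f v) x) ^ Poly_Mapping.lookup m (v, k))"
  unfolding jet_monom_def using assms
  by (intro prod.mono_neutral_left) (auto simp: in_keys_iff)

lemma jet_monom_add: "jet_monom f x (m + m') = jet_monom f x m * jet_monom f x m'"
proof -
  let ?K = "Poly_Mapping.keys m \<union> Poly_Mapping.keys m'"
  have "Poly_Mapping.keys (m + m') \<subseteq> ?K"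
    by (rule keys_add)
  then show ?thesis
    by (simp add: jet_monom_superset[of ?K] lookup_add power_add prod.distrib case_prod_beta)
qed

lemma diff_poly_eval_zero [simp]: "diff_poly_eval 0 f x = 0"
  by (simp add: diff_poly_eval_jet_monom)

lemma diff_poly_eval_single [simp]:
  "diff_poly_eval (Poly_Mapping.single m c) f x = c * jet_monom f x m"
  by (simp add: diff_poly_eval_jet_monom)

lemma diff_poly_eval_add:
  "diff_poly_eval (P + Q) f x = diff_poly_eval P f x + diff_poly_eval Q f x"
  unfolding diff_poly_eval_jet_monom
  by (rule setsum_keys_plus_distrib) (auto simp: algebra_simps)

text \<open>Updating at a key outside the support amounts to adding a single term, which suits the
  additivity of evaluation.\<close>

lemma poly_mapping_add_induct [case_names zero add_single]:
  fixes P :: "'a \<Rightarrow>\<^sub>0 'b::monoid_add"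
  assumes "R 0" and "\<And>P m c. R P \<Longrightarrow> R (P + Poly_Mapping.single m c)"
  shows "R P"
proof (induction P rule: Poly_Mapping.update_induct)
  case (update P m c)
  then have "Poly_Mapping.update m c P = P + Poly_Mapping.single m c"
    by (intro poly_mapping_eqI)
      (auto simp: lookup_update lookup_add lookup_single in_keys_iff when_def)
  with update show ?case
    using assms(2) by simp
qed (rule assms(1))

lemma diff_poly_eval_mult:
  "diff_poly_eval (P * Q) f x = diff_poly_eval P f x * diff_poly_eval Q f x"
proof (induction P rule: poly_mapping_add_induct)
  case (add_single P m c)
  have "diff_poly_eval (Poly_Mapping.single m c * Q) f x =
      c * jet_monom f x m * diff_poly_eval Q f x"
    by (induction Q rule: poly_mapping_add_induct)
      (simp_all add: diff_poly_eval_add mult_single jet_monom_add algebra_simps)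
  with add_single show ?case
    by (simp add: diff_poly_eval_add algebra_simps)
qed simp

lemma diff_poly_funs_add: "diff_poly_funs (P + Q) \<subseteq> diff_poly_funs P \<union> diff_poly_funs Q"
  unfolding diff_poly_funs_def using keys_add[of P Q] by blast

lemma diff_poly_funs_mult: "diff_poly_funs (P * Q) \<subseteq> diff_poly_funs P \<union> diff_poly_funs Q"
proof
  fix v
  assume "v \<in> diff_poly_funs (P * Q)"
  then obtain m where "m \<in> Poly_Mapping.keys (P * Q)" and v: "v \<in> fst ` Poly_Mapping.keys m"
    by (auto simp: diff_poly_funs_def)
  then obtain p q where "m = p + q" "p \<in> Poly_Mapping.keys P" "q \<in> Poly_Mapping.keys Q"
    using keys_mult[of P Q] by blast
  with v show "v \<in> diff_poly_funs P \<union> diff_poly_funs Q"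
    unfolding diff_poly_funs_def using keys_add[of p q] by blast
qed

section \<open>The algebra of differential polynomial operators\<close>

text \<open>Working with the induced operators keeps monomials out of the recursion;
  \<open>diff_polynomial_eval\<close> supplies a polynomial once the operator is known.\<close>

inductive diff_polynomial ::
    "'v set \<Rightarrow> (('v \<Rightarrow> real \<Rightarrow> real) \<Rightarrow> real \<Rightarrow> real) \<Rightarrow> bool" for S where
  const: "diff_polynomial S (\<lambda>f x. c)"
| jet: "v \<in> S \<Longrightarrow> diff_polynomial S (\<lambda>f x. (deriv ^^ k) (f v) x)"
| add: "diff_polynomial S F \<Longrightarrow> diff_polynomial S G \<Longrightarrow> diff_polynomial S (\<lambda>f x. F f x + G f x)"
| mult: "diff_polynomial S F \<Longrightarrow> diff_polynomial S G \<Longrightarrow> diff_polynomial S (\<lambda>f x. F f x * G f x)"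

lemma diff_polynomial_sum:
  "(\<And>i. i \<in> I \<Longrightarrow> diff_polynomial S (F i)) \<Longrightarrow> diff_polynomial S (\<lambda>f x. \<Sum>i\<in>I. F i f x)"
  by (induction I rule: infinite_finite_induct) (auto intro: diff_polynomial.intros)

lemma diff_polynomial_eval:
  "diff_polynomial S F \<Longrightarrow> \<exists>P. diff_poly_funs P \<subseteq> S \<and> F = diff_poly_eval P"
proof (induction rule: diff_polynomial.induct)
  case (const c)
  show ?case
    by (intro exI[of _ "Poly_Mapping.single 0 c"])
      (auto simp: fun_eq_iff diff_poly_funs_def jet_monom_def)
next
  case (jet v k)
  then show ?case
    by (intro exI[of _ "Poly_Mapping.single (Poly_Mapping.single (v, k) 1) 1"])
      (auto simp: fun_eq_iff diff_poly_funs_def jet_monom_def)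
next
  case (add F G)
  then obtain P Q where "diff_poly_funs P \<subseteq> S" "F = diff_poly_eval P"
    "diff_poly_funs Q \<subseteq> S" "G = diff_poly_eval Q"
    by blast
  then show ?case
    using diff_poly_funs_add[of P Q]
    by (intro exI[of _ "P + Q"]) (auto simp: fun_eq_iff diff_poly_eval_add)
next
  case (mult F G)
  then obtain P Q where "diff_poly_funs P \<subseteq> S" "F = diff_poly_eval P"
    "diff_poly_funs Q \<subseteq> S" "G = diff_poly_eval Q"
    by blast
  then show ?case
    using diff_poly_funs_mult[of P Q]
    by (intro exI[of _ "P * Q"]) (auto simp: fun_eq_iff diff_poly_eval_mult)
qed

lemma diff_polynomial_smooth:
  "diff_polynomial S F \<Longrightarrow> (\<And>v. v \<in> S \<Longrightarrow> smooth_fun (f v)) \<Longrightarrow> smooth_fun (F f)"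
  by (induction rule: diff_polynomial.induct)
    (simp_all add: smooth_fun_higher_deriv smooth_fun_add smooth_fun_mult)

text \<open>The sum and product rules need differentiability, hence the smooth arguments.
  \<open>G\<close> is chosen before \<open>f\<close>, so one operator serves all of them.\<close>

lemma diff_polynomial_deriv:
  "diff_polynomial S F \<Longrightarrow>
    \<exists>G. diff_polynomial S G \<and> (\<forall>f. (\<forall>v\<in>S. smooth_fun (f v)) \<longrightarrow> deriv (F f) = G f)"
proof (induction rule: diff_polynomial.induct)
  case (const c)
  show ?case
    by (intro exI[of _ "\<lambda>f x. 0"]) (auto intro: diff_polynomial.const)
next
  case (jet v k)
  have "diff_polynomial S (\<lambda>f x. (deriv ^^ Suc k) (f v) x)"
    using jet by (rule diff_polynomial.jet)
  then show ?case
    by (intro exI[of _ "\<lambda>f x. (deriv ^^ Suc k) (f v) x"]) simp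
next
  case (add F G)
  then obtain F' G' where F'G': "diff_polynomial S F'" "diff_polynomial S G'"
    "\<And>f. (\<forall>v\<in>S. smooth_fun (f v)) \<Longrightarrow> deriv (F f) = F' f"
    "\<And>f. (\<forall>v\<in>S. smooth_fun (f v)) \<Longrightarrow> deriv (G f) = G' f"
    by blast
  have "deriv (\<lambda>x. F f x + G f x) x = F' f x + G' f x" if f: "\<forall>v\<in>S. smooth_fun (f v)" for f x
    using smooth_fun_DERIV[OF diff_polynomial_smooth[OF add.hyps(1)], of f x]
      smooth_fun_DERIV[OF diff_polynomial_smooth[OF add.hyps(2)], of f x] F'G'(3,4)[OF f] f
    by (intro DERIV_imp_deriv DERIV_add) auto
  then show ?case
    using F'G'(1,2)
    by (intro exI[of _ "\<lambda>f x. F' f x + G' f x"]) (auto intro: diff_polynomial.add)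
next
  case (mult F G)
  then obtain F' G' where F'G': "diff_polynomial S F'" "diff_polynomial S G'"
    "\<And>f. (\<forall>v\<in>S. smooth_fun (f v)) \<Longrightarrow> deriv (F f) = F' f"
    "\<And>f. (\<forall>v\<in>S. smooth_fun (f v)) \<Longrightarrow> deriv (G f) = G' f"
    by blast
  have "deriv (\<lambda>x. F f x * G f x) x = F' f x * G f x + G' f x * F f x"
    if f: "\<forall>v\<in>S. smooth_fun (f v)" for f x
    using smooth_fun_DERIV[OF diff_polynomial_smooth[OF mult.hyps(1)], of f x]
      smooth_fun_DERIV[OF diff_polynomial_smooth[OF mult.hyps(2)], of f x] F'G'(3,4)[OF f] f
    by (intro DERIV_imp_deriv DERIV_mult) auto
  then show ?case
    using F'G'(1,2) mult.hyps
    by (intro exI[of _ "\<lambda>f x. F' f x * G f x + G' f x * F f x"])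
      (auto intro!: diff_polynomial.add diff_polynomial.mult)
qed

section \<open>Derivatives in a moving frame\<close>

text \<open>If \<open>\<gamma>\<^sub>x\<^sup>(\<^sup>n\<^sup>) = \<Sum>\<^sub>i u\<^sub>i \<gamma>\<^sub>x\<^sup>(\<^sup>i\<^sup>-\<^sup>1\<^sup>)\<close>, then \<open>jet_coeff n f k i\<close> is the coefficient of \<open>\<gamma>\<^sub>x\<^sup>(\<^sup>i\<^sup>)\<close> in
  the \<open>k\<close>-th derivative of \<open>\<Sum>\<^sub>i \<xi>\<^sub>i \<gamma>\<^sub>x\<^sup>(\<^sup>i\<^sup>)\<close>, where \<open>f (Inl i) = u\<^sub>i\<close> and \<open>f (Inr i) = \<xi>\<^sub>i\<close>.
  It is the entry of \<open>C\<close> in row \<open>i\<close> and column \<open>k\<close>, counted from 0.\<close>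

primrec jet_coeff ::
    "nat \<Rightarrow> (nat + nat \<Rightarrow> real \<Rightarrow> real) \<Rightarrow> nat \<Rightarrow> nat \<Rightarrow> real \<Rightarrow> real" where
  "jet_coeff n f 0 = (\<lambda>i x. f (Inr i) x)"
| "jet_coeff n f (Suc k) = (\<lambda>i x. deriv (jet_coeff n f k i) x
     + (if i = 0 then 0 else jet_coeff n f k (i - 1) x)
     + (if i < n - 1 then f (Inl (Suc i)) x else 0) * jet_coeff n f k (n - 1) x)"

definition jet_trace :: "nat \<Rightarrow> (nat + nat \<Rightarrow> real \<Rightarrow> real) \<Rightarrow> real \<Rightarrow> real" where
  "jet_trace n f x = (\<Sum>k<n. jet_coeff n f k k x)"

text \<open>The shift by \<open>b\<close> carries \<open>\<xi>\<^sub>0\<close> down one row per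
  column, so it sits on the diagonal in every column. For \<open>i \<ge> Suc k\<close> the
  derivative and curvature terms of the step use only entries of column \<open>k\<close> strictly
  below the diagonal, which are free of it.\<close>

lemma jet_coeff_upper:
  "k < n \<Longrightarrow> k \<le> i \<Longrightarrow> jet_coeff n f k i =
    (\<lambda>x. jet_coeff n (f(Inr 0 := \<lambda>x. 0)) k i x + (if i = k then f (Inr 0) x else 0))"
proof -
  define g where "g = f(Inr 0 := \<lambda>x. 0)"
  have g: "g (Inl j) = f (Inl j)" "g (Inr j) = (if j = 0 then (\<lambda>x. 0) else f (Inr j))" for j
    by (simp_all add: g_def)
  have "k < n \<Longrightarrow> k \<le> i \<Longrightarrow>
    jet_coeff n f k i = (\<lambda>x. jet_coeff n g k i x + (if i = k then f (Inr 0) x else 0))"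
  proof (induction k arbitrary: i)
    case (Suc k)
    then have "jet_coeff n f k i = jet_coeff n g k i"
      and "jet_coeff n f k (n - 1) = jet_coeff n g k (n - 1)"
      by auto
    moreover have "jet_coeff n f k (i - 1) =
        (\<lambda>x. jet_coeff n g k (i - 1) x + (if i = Suc k then f (Inr 0) x else 0))"
      using Suc.IH[of "i - 1"] Suc.prems by (cases i) auto
    ultimately show ?case
      using Suc.prems by (auto simp: g intro!: ext)
  qed (auto simp: g)
  then show "k < n \<Longrightarrow> k \<le> i \<Longrightarrow> jet_coeff n f k i =
    (\<lambda>x. jet_coeff n (f(Inr 0 := \<lambda>x. 0)) k i x + (if i = k then f (Inr 0) x else 0))"
    unfolding g_def .
qed

lemma jet_trace_split:
  "jet_trace n f x = jet_trace n (f(Inr 0 := \<lambda>x. 0)) x + real n * f (Inr 0) x"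
proof -
  have "jet_trace n f x = (\<Sum>k<n. jet_coeff n (f(Inr 0 := \<lambda>x. 0)) k k x + f (Inr 0) x)"
    unfolding jet_trace_def by (intro sum.cong refl) (subst jet_coeff_upper, auto)
  then show ?thesis
    by (simp add: jet_trace_def sum.distrib)
qed

text \<open>With \<open>f (Inr 0)\<close> set to 0, the recursion consists of derivatives, sums and
  products of the remaining functions. \<open>F\<close> depends on \<open>n\<close>,
  \<open>k\<close> and \<open>i\<close>, but not on \<open>f\<close>.\<close>

lemma jet_coeff_diff_polynomial:
  assumes "i < n"
  shows "\<exists>F. diff_polynomial (Inl ` {1..n-1} \<union> Inr ` {1..n-1}) F \<and>
    (\<forall>f. (\<forall>v\<in>Inl ` {1..n-1} \<union> Inr ` {1..n-1}. smooth_fun (f v)) \<longrightarrow>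
      jet_coeff n (f(Inr 0 := \<lambda>x. 0)) k i = F f)"
  using assms
proof (induction k arbitrary: i)
  case 0
  show ?case
  proof (cases "i = 0")
    case True
    then show ?thesis
      by (intro exI[of _ "\<lambda>f x. 0"]) (auto intro: diff_polynomial.const)
  next
    case False
    with 0 have "diff_polynomial (Inl ` {1..n-1} \<union> Inr ` {1..n-1})
        (\<lambda>f x. (deriv ^^ 0) (f (Inr i)) x)"
      by (intro diff_polynomial.jet) auto
    with False show ?thesis
      by (intro exI[of _ "\<lambda>f x. f (Inr i) x"]) auto
  qed
next
  case (Suc k)
  let ?S = "Inl ` {1..n-1} \<union> Inr ` {1..n-1} :: (nat + nat) set"
  let ?smooth = "\<lambda>f. \<forall>v\<in>?S. smooth_fun (f v)"
  have "\<exists>F. diff_polynomial ?S F \<and> (\<forall>f. ?smooth f \<longrightarrow> jet_coeff n (f(Inr 0 := \<lambda>x. 0)) k j = F f)"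
    if "j < n" for j
    using Suc.IH that .
  then obtain F where F: "\<And>j. j < n \<Longrightarrow> diff_polynomial ?S (F j)"
    "\<And>j f. j < n \<Longrightarrow> ?smooth f \<Longrightarrow> jet_coeff n (f(Inr 0 := \<lambda>x. 0)) k j = F j f"
    by metis
  obtain G where G: "diff_polynomial ?S G" "\<And>f. ?smooth f \<Longrightarrow> deriv (F i f) = G f"
    using diff_polynomial_deriv[OF F(1)[OF Suc.prems]] by blast
  define A where "A = (if i = 0 then (\<lambda>f x. 0) else F (i - 1))"
  \<comment> \<open>The bottom row has no curvature coefficient. The zeroth iterate of
    \<open>deriv\<close> gives the others the shape required by
    \<open>diff_polynomial.jet\<close>.\<close>
  define W :: "(nat + nat \<Rightarrow> real \<Rightarrow> real) \<Rightarrow> real \<Rightarrow> real"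
    where "W = (if i < n - 1 then \<lambda>f x. (deriv ^^ 0) (f (Inl (Suc i))) x else (\<lambda>f x. 0))"
  have "diff_polynomial ?S A"
    using F(1) Suc.prems by (auto simp: A_def intro: diff_polynomial.const)
  moreover have "diff_polynomial ?S W"
  proof (cases "i < n - 1")
    case True
    then have "Inl (Suc i) \<in> ?S"
      by auto
    then show ?thesis
      unfolding W_def using True by (simp only: if_True diff_polynomial.jet)
  qed (simp add: W_def diff_polynomial.const)
  ultimately have "diff_polynomial ?S (\<lambda>f x. G f x + A f x + W f x * F (n - 1) f x)"
    using G(1) F(1)[of "n - 1"] Suc.prems
    by (intro diff_polynomial.add diff_polynomial.mult) auto
  moreover have "jet_coeff n (f(Inr 0 := \<lambda>x. 0)) (Suc k) i =
      (\<lambda>x. G f x + A f x + W f x * F (n - 1) f x)" if "?smooth f" for f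
    using that F(2)[OF _ that] G(2)[OF that] Suc.prems by (auto simp: A_def W_def intro!: ext)
  ultimately show ?case
    by blast
qed

lemma jet_trace_diff_polynomial:
  "\<exists>F. diff_polynomial (Inl ` {1..n-1} \<union> Inr ` {1..n-1}) F \<and>
    (\<forall>f. (\<forall>v\<in>Inl ` {1..n-1} \<union> Inr ` {1..n-1}. smooth_fun (f v)) \<longrightarrow>
      jet_trace n (f(Inr 0 := \<lambda>x. 0)) = F f)"
proof -
  let ?S = "Inl ` {1..n-1} \<union> Inr ` {1..n-1} :: (nat + nat) set"
  have "\<forall>k\<in>{..<n}. \<exists>F. diff_polynomial ?S F \<and> (\<forall>f. (\<forall>v\<in>?S. smooth_fun (f v)) \<longrightarrow>
      jet_coeff n (f(Inr 0 := \<lambda>x. 0)) k k = F f)"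
    using jet_coeff_diff_polynomial by blast
  then obtain F where F: "\<And>k. k \<in> {..<n} \<Longrightarrow> diff_polynomial ?S (F k)"
    "\<And>k f. k \<in> {..<n} \<Longrightarrow> \<forall>v\<in>?S. smooth_fun (f v) \<Longrightarrow>
      jet_coeff n (f(Inr 0 := \<lambda>x. 0)) k k = F k f"
    by metis
  show ?thesis
  proof (intro exI conjI allI impI)
    show "diff_polynomial ?S (\<lambda>f x. \<Sum>k<n. F k f x)"
      by (rule diff_polynomial_sum) (rule F)
    fix f
    assume "\<forall>v\<in>?S. smooth_fun (f v)"
    then show "jet_trace n (f(Inr 0 := \<lambda>x. 0)) = (\<lambda>x. \<Sum>k<n. F k f x)"
      unfolding jet_trace_def using F(2) by (intro ext sum.cong refl) metis
  qed
qed

lemma smooth_fun_jet_coeff: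
  assumes "\<And>j. j \<in> {1..n-1} \<Longrightarrow> smooth_fun (f (Inl j))" "\<And>j. j < n \<Longrightarrow> smooth_fun (f (Inr j))"
  shows "i < n \<Longrightarrow> smooth_fun (jet_coeff n f k i)"
proof (induction k arbitrary: i)
  case (Suc k)
  have "smooth_fun (\<lambda>x. if i = 0 then 0 else jet_coeff n f k (i - 1) x)"
    using Suc by (cases "i = 0") auto
  moreover have "smooth_fun (\<lambda>x. if i < n - 1 then f (Inl (Suc i)) x else 0)"
    using assms(1)[of "Suc i"] by (cases "i < n - 1") auto
  moreover have "smooth_fun (\<lambda>x. deriv (jet_coeff n f k i) x)" "smooth_fun (jet_coeff n f k (n - 1))"
    using Suc smooth_fun_deriv by auto
  ultimately show ?case
    by (simp only: jet_coeff.simps smooth_fun_add smooth_fun_mult)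
qed (use assms in auto)

lemma smooth_fun_jet_trace:
  assumes "\<And>j. j \<in> {1..n-1} \<Longrightarrow> smooth_fun (f (Inl j))" "\<And>j. j < n \<Longrightarrow> smooth_fun (f (Inr j))"
  shows "smooth_fun (jet_trace n f)"
  unfolding jet_trace_def using smooth_fun_jet_coeff[of n f] assms
  by (intro smooth_fun_sum) auto

section \<open>The equation \<open>C\<^sub>x + [b + u, C] \<in> V\<^sub>n\<close>\<close>

lemma V_space_iff:
  "A \<in> V_space n \<longleftrightarrow>
    A \<in> carrier_mat n n \<and> (\<forall>i<n. \<forall>j<n. j < n - 1 \<or> i = n - 1 \<longrightarrow> A $$ (i, j) = 0)"
proof
  assume A: "A \<in> carrier_mat n n \<and> (\<forall>i<n. \<forall>j<n. j < n - 1 \<or> i = n - 1 \<longrightarrow> A $$ (i, j) = 0)"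
  have "A = mat n n (\<lambda>(i, j). if i < n - 1 \<and> j = n - 1 then A $$ (i, n - 1) else 0)"
  proof (rule eq_matI)
    fix i j
    assume "i < dim_row (mat n n (\<lambda>(i, j). if i < n - 1 \<and> j = n - 1 then A $$ (i, n - 1) else 0))"
      "j < dim_col (mat n n (\<lambda>(i, j). if i < n - 1 \<and> j = n - 1 then A $$ (i, n - 1) else 0))"
    then have "i < n" "j < n"
      by auto
    then consider "j < n - 1" | "i = n - 1" | "i < n - 1" "j = n - 1"
      by linarith
    with A \<open>i < n\<close> \<open>j < n\<close> show "A $$ (i, j) =
        mat n n (\<lambda>(i, j). if i < n - 1 \<and> j = n - 1 then A $$ (i, n - 1) else 0) $$ (i, j)"
      by cases auto
  qed (use A in auto)
  then show "A \<in> V_space n"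
    unfolding V_space_def by (auto intro: exI[of _ "\<lambda>i. A $$ (i, n - 1)"])
qed (auto simp: V_space_def)

section \<open>Entries of products with \<open>b_mat n + u\<close>\<close>

lemma b_mat_carrier [simp]: "b_mat n \<in> carrier_mat n n"
  by (simp add: b_mat_def)

lemma index_mult_mat_sum:
  assumes "A \<in> carrier_mat n n" "B \<in> carrier_mat n n" "i < n" "j < n"
  shows "(A * B) $$ (i, j) = (\<Sum>k<n. A $$ (i, k) * B $$ (k, j))"
  using assms by (auto simp: scalar_prod_def atLeast0LessThan)

lemma b_plus_u_index:
  assumes "u \<in> V_space n" "i < n" "k < n"
  shows "(b_mat n + u) $$ (i, k) =
    (if i = k + 1 then 1 else 0) + (if k = n - 1 then u $$ (i, n - 1) else 0)"
  using assms by (auto simp: V_space_iff b_mat_def)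

text \<open>From the left, \<open>b_mat n\<close> shifts rows down by one, and \<open>u\<close>,
  being supported in its last column, adds multiples of the last row of \<open>C\<close>.\<close>

lemma b_plus_u_mult_index:
  assumes "u \<in> V_space n" "C \<in> carrier_mat n n" "i < n" "j < n"
  shows "((b_mat n + u) * C) $$ (i, j) =
    (if i = 0 then 0 else C $$ (i - 1, j)) + u $$ (i, n - 1) * C $$ (n - 1, j)"
proof -
  have "((b_mat n + u) * C) $$ (i, j) = (\<Sum>k<n. (b_mat n + u) $$ (i, k) * C $$ (k, j))"
    using assms by (intro index_mult_mat_sum) (auto simp: V_space_iff)
  also have "\<dots> = (\<Sum>k<n. (if i = k + 1 then C $$ (k, j) else 0) +
        (if k = n - 1 then u $$ (i, n - 1) * C $$ (k, j) else 0))"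
    using assms(3)
    by (intro sum.cong refl, subst b_plus_u_index[OF assms(1)]) (auto simp: algebra_simps)
  also have "\<dots> = (\<Sum>k<n. if i = k + 1 then C $$ (k, j) else 0) + u $$ (i, n - 1) * C $$ (n - 1, j)"
    using assms by (simp add: sum.distrib)
  also have "(\<Sum>k<n. if i = k + 1 then C $$ (k, j) else 0) = (if i = 0 then 0 else C $$ (i - 1, j))"
    using assms by (cases i) auto
  finally show ?thesis .
qed

text \<open>From the right, \<open>b_mat n\<close> shifts columns to the left; \<open>u\<close>
  affects only the last column, which the bound on \<open>j\<close> excludes.\<close>

lemma mult_b_plus_u_index:
  assumes "u \<in> V_space n" "C \<in> carrier_mat n n" "i < n" "j < n - 1"
  shows "(C * (b_mat n + u)) $$ (i, j) = C $$ (i, Suc j)"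
proof -
  have "(C * (b_mat n + u)) $$ (i, j) = (\<Sum>k<n. C $$ (i, k) * (b_mat n + u) $$ (k, j))"
    using assms by (intro index_mult_mat_sum) (auto simp: V_space_iff)
  also have "\<dots> = (\<Sum>k<n. if k = j + 1 then C $$ (i, k) else 0)"
    using assms(4) by (intro sum.cong refl, subst b_plus_u_index[OF assms(1)]) auto
  finally show ?thesis
    using assms by simp
qed

lemma sum_diag_commutator:
  fixes A B :: "'a::comm_ring_1 mat"
  assumes "A \<in> carrier_mat n n" "B \<in> carrier_mat n n"
  shows "(\<Sum>i<n. (A * B - B * A) $$ (i, i)) = 0"
proof -
  have "(\<Sum>i<n. (A * B) $$ (i, i)) = (\<Sum>i<n. \<Sum>k<n. A $$ (i, k) * B $$ (k, i))"
    using assms by (simp add: index_mult_mat_sum[OF assms] del: index_mult_mat)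
  also have "\<dots> = (\<Sum>k<n. \<Sum>i<n. B $$ (k, i) * A $$ (i, k))"
    by (subst sum.swap) (simp add: mult.commute)
  also have "\<dots> = (\<Sum>k<n. (B * A) $$ (k, k))"
    using assms by (simp add: index_mult_mat_sum[OF assms(2,1)] del: index_mult_mat)
  finally have "(\<Sum>i<n. (A * B) $$ (i, i) - (B * A) $$ (i, i)) = 0"
    by (simp add: sum_subtractf)
  moreover have "(\<Sum>i<n. (A * B - B * A) $$ (i, i)) =
      (\<Sum>i<n. (A * B) $$ (i, i) - (B * A) $$ (i, i))"
    using assms by (intro sum.cong refl index_minus_mat(1)) auto
  ultimately show ?thesis
    by simp
qed

section \<open>The curvature equation as a recursion for the columns of \<open>C\<close>\<close>

lemma phi_args_simps [simp]:
  "phi_args n u \<xi> (Inl i) = (\<lambda>x. u x $$ (i - 1, n - 1))" "phi_args n u \<xi> (Inr i) = \<xi> i"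
  by (simp_all add: phi_args_def)

text \<open>The lower right corner of \<open>u x\<close> is 0, which absorbs the case distinction in
  \<open>jet_coeff\<close>; \<open>Inl (Suc i)\<close> names the entry in row
  \<open>i\<close>.\<close>

lemma jet_coeff_phi_args_Suc:
  assumes "u x \<in> V_space n" "i < n"
  shows "jet_coeff n (phi_args n u \<xi>) (Suc k) i x =
    deriv (jet_coeff n (phi_args n u \<xi>) k i) x
    + (if i = 0 then 0 else jet_coeff n (phi_args n u \<xi>) k (i - 1) x)
    + u x $$ (i, n - 1) * jet_coeff n (phi_args n u \<xi>) k (n - 1) x"
proof -
  have "(if i < n - 1 then phi_args n u \<xi> (Inl (Suc i)) x else 0) = u x $$ (i, n - 1)"
    using assms by (cases "i = n - 1") (auto simp: V_space_iff)
  then show ?thesis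
    by simp
qed

lemma curvature_equation_index:
  assumes "u x \<in> V_space n" "C x \<in> carrier_mat n n" "i < n" "j < n - 1"
  shows "(mat_deriv n C x + ((b_mat n + u x) * C x - C x * (b_mat n + u x))) $$ (i, j) =
    deriv (\<lambda>t. C t $$ (i, j)) x + (if i = 0 then 0 else C x $$ (i - 1, j))
    + u x $$ (i, n - 1) * C x $$ (n - 1, j) - C x $$ (i, Suc j)"
proof -
  have u: "u x \<in> carrier_mat n n"
    using assms(1) by (simp add: V_space_iff)
  have "(mat_deriv n C x + ((b_mat n + u x) * C x - C x * (b_mat n + u x))) $$ (i, j) =
      deriv (\<lambda>t. C t $$ (i, j)) x
      + (((b_mat n + u x) * C x) $$ (i, j) - (C x * (b_mat n + u x)) $$ (i, j))"
    using assms u by (simp add: mat_deriv_def del: index_mult_mat(1))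
  then show ?thesis
    using assms
    by (simp add: b_plus_u_mult_index mult_b_plus_u_index del: index_mult_mat(1))
qed

text \<open>Vanishing of the expression in column \<open>k\<close> expresses column
  \<open>Suc k\<close> of \<open>C\<close> through column \<open>k\<close> by the recursion of
  \<open>jet_coeff\<close>, so the first column determines all others.\<close>

lemma curvature_equation_jet_coeff:
  assumes "\<And>x. u x \<in> V_space n" "\<And>x. C x \<in> carrier_mat n n"
    and "\<And>x. mat_deriv n C x + ((b_mat n + u x) * C x - C x * (b_mat n + u x)) \<in> V_space n"
  shows "i < n \<Longrightarrow> k < n \<Longrightarrow>
    (\<lambda>x. C x $$ (i, k)) = jet_coeff n (phi_args n u (\<lambda>i x. C x $$ (i, 0))) k i"
proof (induction k arbitrary: i)
  case (Suc k)
  let ?J = "jet_coeff n (phi_args n u (\<lambda>i x. C x $$ (i, 0)))"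
  show ?case
  proof
    fix x
    have IH: "(\<lambda>x. C x $$ (j, k)) = ?J k j" if "j < n" for j
      using Suc that by simp
    have "deriv (\<lambda>t. C t $$ (i, k)) x + (if i = 0 then 0 else C x $$ (i - 1, k))
        + u x $$ (i, n - 1) * C x $$ (n - 1, k) - C x $$ (i, Suc k) = 0"
      using curvature_equation_index[of u x n C i k] assms Suc.prems
      by (auto simp: V_space_iff)
    moreover have "C x $$ (i - 1, k) = ?J k (i - 1) x" "C x $$ (n - 1, k) = ?J k (n - 1) x"
      using fun_cong[OF IH[of "i - 1"]] fun_cong[OF IH[of "n - 1"]] Suc.prems by auto
    ultimately show "C x $$ (i, Suc k) = ?J (Suc k) i x"
      using IH[of i] Suc.prems
      by (cases "i = 0")
        (simp_all add: jet_coeff_phi_args_Suc[where u=u, OF assms(1)] del: jet_coeff.simps)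
  qed
qed (simp add: fun_eq_iff)

section \<open>Existence and characterization of \<open>\<phi>\<^sub>n\<close>\<close>

lemma is_phi_exists:
  assumes "n \<ge> 1"
  shows "\<exists>P. is_phi n P"
proof -
  let ?S = "Inl ` {1..n-1} \<union> Inr ` {1..n-1} :: (nat + nat) set"
  obtain F where F: "diff_polynomial ?S F"
    "\<And>f. \<forall>v\<in>?S. smooth_fun (f v) \<Longrightarrow> jet_trace n (f(Inr 0 := \<lambda>x. 0)) = F f"
    using jet_trace_diff_polynomial[of n] by blast
  \<comment> \<open>By \<open>jet_trace_split\<close>, trace 0 means
    \<open>F f x + real n * f (Inr 0) x = 0\<close>; the factor comes from solving for
    \<open>f (Inr 0) x\<close>.\<close>
  have "diff_polynomial ?S (\<lambda>f x. (- 1 / real n) * F f x)"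
    by (intro diff_polynomial.mult diff_polynomial.const F(1))
  then obtain P where P: "diff_poly_funs P \<subseteq> ?S"
    "\<And>f x. (- 1 / real n) * F f x = diff_poly_eval P f x"
    using diff_polynomial_eval[of ?S "\<lambda>f x. (- 1 / real n) * F f x"] by (metis (no_types))
  have "is_phi n P"
    unfolding is_phi_def
  proof (intro conjI allI impI ext P(1))
    fix u C x
    assume u: "smooth_mat n u" "\<forall>x. u x \<in> V_space n"
      and C: "smooth_mat n C" "\<forall>x. C x \<in> sl_mat n"
      and eq: "\<forall>x. mat_deriv n C x + ((b_mat n + u x) * C x - C x * (b_mat n + u x)) \<in> V_space n"
    let ?f = "phi_args n u (\<lambda>i x. C x $$ (i, 0))"
    have "\<forall>v\<in>?S. smooth_fun (?f v)"
      using u(1) C(1) assms by (auto simp: smooth_mat_def)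
    then have F_eq: "jet_trace n (?f(Inr 0 := \<lambda>x. 0)) x = F ?f x"
      using F(2) by metis
    have "jet_trace n ?f x = (\<Sum>k<n. C x $$ (k, k))"
      unfolding jet_trace_def
    proof (intro sum.cong refl)
      fix k
      assume "k \<in> {..<n}"
      then have "(\<lambda>x. C x $$ (k, k)) = jet_coeff n ?f k k"
        using curvature_equation_jet_coeff[of u n C k k] u C(1) eq by (auto simp: smooth_mat_def)
      then show "jet_coeff n ?f k k x = C x $$ (k, k)"
        by metis
    qed
    also have "\<dots> = 0"
      using C(2) by (simp add: sl_mat_def)
    finally have "F ?f x + real n * C x $$ (0, 0) = 0"
      using jet_trace_split[of n ?f x] F_eq by simp
    then have "C x $$ (0, 0) = (- 1 / real n) * F ?f x"
      using assms by (simp add: field_simps)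
    then show "C x $$ (0, 0) = diff_poly_eval P ?f x"
      using P(2) by simp
  qed
  then show ?thesis ..
qed

lemma diff_poly_eval_cong:
  assumes "\<And>v. v \<in> diff_poly_funs P \<Longrightarrow> f v = g v"
  shows "diff_poly_eval P f = diff_poly_eval P g"
  unfolding diff_poly_eval_def
  by (intro ext sum.cong prod.cong arg_cong2[of _ _ _ _ "(*)"] refl)
    (use assms in \<open>force simp: diff_poly_funs_def\<close>)

text \<open>Among the entries of \<open>C\<^sub>x + [b + u, C]\<close> that must vanish, the recursion for the columns of
  \<open>C\<close> leaves open only the lower right corner; it vanishes because \<open>C\<^sub>x\<close> and the commutator have
  trace 0.\<close>

lemma is_phi_jet_trace_zero:
  assumes "n \<ge> 1" "is_phi n P" "smooth_mat n u" "\<And>x. u x \<in> V_space n"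
    and "\<And>i. i < n \<Longrightarrow> smooth_fun (\<xi> i)" and "\<And>x. jet_trace n (phi_args n u \<xi>) x = 0"
  shows "\<xi> 0 = diff_poly_eval P (phi_args n u \<xi>)"
proof -
  let ?J = "jet_coeff n (phi_args n u \<xi>)"
  define C where "C x = mat n n (\<lambda>(i, j). ?J j i x)" for x
  have C_carrier: "C x \<in> carrier_mat n n" for x
    by (simp add: C_def)
  have C_index: "(\<lambda>x. C x $$ (i, j)) = ?J j i" if "i < n" "j < n" for i j
    using that by (simp add: C_def fun_eq_iff)
  have smooth_J: "smooth_fun (?J j i)" if "i < n" for i j
    using that assms(3,5) by (intro smooth_fun_jet_coeff) (auto simp: smooth_mat_def)
  have smooth_C: "smooth_mat n C"
    unfolding smooth_mat_def using C_carrier C_index smooth_J by simp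
  have trace_C: "(\<Sum>i<n. C x $$ (i, i)) = 0" for x
    using assms(6)[of x] by (simp add: C_def jet_trace_def)
  define M where "M x = mat_deriv n C x + ((b_mat n + u x) * C x - C x * (b_mat n + u x))" for x
  have bu: "b_mat n + u x \<in> carrier_mat n n" for x
    using assms(4)[of x] by (simp add: V_space_iff)
  have M_carrier: "M x \<in> carrier_mat n n" for x
    unfolding M_def mat_deriv_def
    by (intro add_carrier_mat minus_carrier_mat mult_carrier_mat[OF C_carrier bu])
  \<comment> \<open>For \<open>j < n - 1\<close> the next column still belongs to \<open>C\<close>,
    and it was defined by the very recursion that this entry expresses.\<close>
  have M_zero: "M x $$ (i, j) = 0" if "i < n" "j < n - 1" for x i j
  proof -
    have "C x $$ (i', j') = ?J j' i' x" if "i' < n" "j' < n" for i' j'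
      using that by (simp add: C_def)
    then show ?thesis
      unfolding M_def curvature_equation_index[of u x n C, OF assms(4) C_carrier that]
      using that C_index[of i j] assms(4)
      by (auto simp add: jet_coeff_phi_args_Suc simp del: jet_coeff.simps)
  qed
  have M_corner: "M x $$ (n - 1, n - 1) = 0" for x
  proof -
    have "((\<lambda>x. \<Sum>i<n. C x $$ (i, i)) has_real_derivative
        (\<Sum>i<n. deriv (\<lambda>t. C t $$ (i, i)) x)) (at x)"
      using smooth_C by (intro DERIV_sum smooth_fun_DERIV) (auto simp: smooth_mat_def)
    then have "(\<Sum>i<n. deriv (\<lambda>t. C t $$ (i, i)) x) = 0"
      using trace_C DERIV_unique[OF _ DERIV_const[of 0]] by simp
    moreover have "(\<Sum>i<n. M x $$ (i, i)) = (\<Sum>i<n. deriv (\<lambda>t. C t $$ (i, i)) x +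
        ((b_mat n + u x) * C x - C x * (b_mat n + u x)) $$ (i, i))"
      unfolding M_def using bu[of x] C_carrier[of x]
      by (intro sum.cong refl, subst index_add_mat(1)) (auto simp: mat_deriv_def)
    ultimately have "(\<Sum>i<n. M x $$ (i, i)) = 0"
      using sum_diag_commutator[OF bu C_carrier] by (simp add: sum.distrib)
    also have "(\<Sum>i<n. M x $$ (i, i)) = (\<Sum>i<n. if i = n - 1 then M x $$ (i, i) else 0)"
      using M_zero by (intro sum.cong) auto
    finally show ?thesis
      using assms(1) by simp
  qed
  have M: "M x \<in> V_space n" for x
    unfolding V_space_iff using M_carrier M_zero M_corner
    by (metis One_nat_def Suc_pred assms(1) less_SucE less_eq_Suc_le)
  have "(\<lambda>x. C x $$ (0, 0)) = diff_poly_eval P (phi_args n u (\<lambda>i x. C x $$ (i, 0)))"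
    using assms(2-4) smooth_C M C_carrier trace_C by (simp add: is_phi_def M_def sl_mat_def)
  \<comment> \<open>The first column of \<open>C\<close> is given by \<open>\<xi>\<close> for row
    indices \<open>i < n\<close>, and \<open>P\<close> names only functions in that range.\<close>
  moreover have "diff_poly_eval P (phi_args n u (\<lambda>i x. C x $$ (i, 0))) =
      diff_poly_eval P (phi_args n u \<xi>)"
  proof (rule diff_poly_eval_cong)
    fix v
    assume "v \<in> diff_poly_funs P"
    then have "v \<in> Inl ` {1..n-1} \<union> Inr ` {1..n-1}"
      using assms(2) by (auto simp: is_phi_def)
    then show "phi_args n u (\<lambda>i x. C x $$ (i, 0)) v = phi_args n u \<xi> v"
      using C_index by auto
  qed
  ultimately show ?thesis
    using C_index[of 0 0] assms(1) by simp
qed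

text \<open>For the converse, \<open>\<xi>\<^sub>0\<close> is replaced by the unique function for which the trace vanishes;
  this does not affect the arguments of \<open>\<phi>\<^sub>n\<close>.\<close>

lemma is_phi_iff_jet_trace_zero:
  assumes "n \<ge> 1" "is_phi n P" "smooth_mat n u" "\<And>x. u x \<in> V_space n"
    and "\<And>i. i < n \<Longrightarrow> smooth_fun (\<xi> i)"
  shows "(\<forall>x. jet_trace n (phi_args n u \<xi>) x = 0) \<longleftrightarrow> \<xi> 0 = diff_poly_eval P (phi_args n u \<xi>)"
proof
  assume \<xi>: "\<xi> 0 = diff_poly_eval P (phi_args n u \<xi>)"
  let ?f = "(phi_args n u \<xi>)(Inr 0 := \<lambda>x. 0)"
  define \<eta> where "\<eta> = \<xi>(0 := \<lambda>x. (- 1 / real n) * jet_trace n ?f x)"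
  \<comment> \<open>\<open>\<eta>\<close> and \<open>\<xi>\<close> differ at most at index 0, which
    is overwritten on both sides; hence their reduced traces agree.\<close>
  have f: "(phi_args n u \<eta>)(Inr 0 := \<lambda>x. 0) = ?f"
    by (auto simp: fun_eq_iff phi_args_def \<eta>_def split: sum.splits)
  have trace: "jet_trace n (phi_args n u \<eta>) x = 0" for x
    using assms(1) by (subst jet_trace_split, subst f) (simp add: \<eta>_def)
  have "smooth_fun (jet_trace n ?f)"
    using assms(3,5) by (intro smooth_fun_jet_trace) (auto simp: smooth_mat_def)
  then have "smooth_fun (\<eta> i)" if "i < n" for i
    using assms(5)[OF that] unfolding \<eta>_def
    by (cases "i = 0") (use smooth_fun_mult[OF smooth_fun_const[of "- 1 / real n"]] in auto)
  then have "\<eta> 0 = diff_poly_eval P (phi_args n u \<eta>)"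
    using is_phi_jet_trace_zero[OF assms(1-4), of \<eta>] trace by blast
  also have "\<dots> = diff_poly_eval P (phi_args n u \<xi>)"
  proof (rule diff_poly_eval_cong)
    fix v
    assume "v \<in> diff_poly_funs P"
    then have "v \<in> Inl ` {1..n-1} \<union> Inr ` {1..n-1}"
      using assms(2) by (auto simp: is_phi_def)
    then show "phi_args n u \<eta> v = phi_args n u \<xi> v"
      by (auto simp: \<eta>_def)
  qed
  \<comment> \<open>Both \<open>\<eta> 0\<close> and \<open>\<xi> 0\<close> equal the value of
    \<open>P\<close> at \<open>\<xi>\<close>, so the replacement changed nothing.\<close>
  finally have "\<eta> = \<xi>"
    using \<xi> by (auto simp: \<eta>_def)
  with trace show "\<forall>x. jet_trace n (phi_args n u \<xi>) x = 0"
    by simp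
next
  assume "\<forall>x. jet_trace n (phi_args n u \<xi>) x = 0"
  with assms show "\<xi> 0 = diff_poly_eval P (phi_args n u \<xi>)"
    by (intro is_phi_jet_trace_zero) auto
qed

section \<open>Tangent vector fields along a central affine curve\<close>

text \<open>The moving frame \<open>g\<close>, that is, the Wronskian matrix of the components of
  \<open>\<gamma>\<close>.\<close>

definition affine_frame :: "nat \<Rightarrow> (real \<Rightarrow> real vec) \<Rightarrow> real \<Rightarrow> real mat" where
  "affine_frame n \<gamma> x = mat_of_cols n (map (\<lambda>j. curve_deriv n j \<gamma> x) [0..<n])"

lemma affine_frame_carrier [simp]: "affine_frame n \<gamma> x \<in> carrier_mat n n"
  by (auto simp: affine_frame_def)

lemma affine_frame_dim [simp]:
  "dim_row (affine_frame n \<gamma> x) = n" "dim_col (affine_frame n \<gamma> x) = n"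
  by (simp_all add: affine_frame_def)

lemma affine_frame_index:
  fixes \<gamma> :: "real \<Rightarrow> real vec"
  shows "k < n \<Longrightarrow> j < n \<Longrightarrow> affine_frame n \<gamma> x $$ (k, j) = (deriv ^^ j) (\<lambda>t. \<gamma> t $ k) x"
  by (simp add: affine_frame_def mat_of_cols_index curve_deriv_def)

text \<open>Cramer's rule: the last hypothesis says that \<open>v\<close> is the frame applied to
  \<open>c\<close>, and the frame has determinant 1.\<close>

lemma det_affine_frame_replace:
  fixes \<gamma> :: "real \<Rightarrow> real vec"
  assumes "v \<in> carrier_vec n" "c \<in> carrier_vec n" "i < n" "det (affine_frame n \<gamma> x) = 1"
    and "\<And>k. k < n \<Longrightarrow> v $ k = (\<Sum>j<n. c $ j * (deriv ^^ j) (\<lambda>t. \<gamma> t $ k) x)"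
  shows "det (mat_of_cols n (map (\<lambda>j. if j = i then v else curve_deriv n j \<gamma> x) [0..<n])) = c $ i"
proof -
  have "v = affine_frame n \<gamma> x *\<^sub>v c"
  proof (rule eq_vecI)
    fix k
    assume "k < dim_vec (affine_frame n \<gamma> x *\<^sub>v c)"
    then have k: "k < n"
      by simp
    then have "(affine_frame n \<gamma> x *\<^sub>v c) $ k = (\<Sum>j<n. affine_frame n \<gamma> x $$ (k, j) * c $ j)"
      using assms(2)
      by (auto simp: scalar_prod_def atLeast0LessThan intro!: sum.cong)
    then show "v $ k = (affine_frame n \<gamma> x *\<^sub>v c) $ k"
      using k assms(5)[OF k] by (simp add: affine_frame_index mult.commute)
  qed (use assms(1) in auto)
  moreover have "mat_of_cols n (map (\<lambda>j. if j = i then v else curve_deriv n j \<gamma> x) [0..<n]) =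
      replace_col (affine_frame n \<gamma> x) v i"
    unfolding replace_col_def by (rule eq_matI) (auto simp: affine_frame_def mat_of_cols_index)
  ultimately show ?thesis
    using cramer_lemma_mat[OF affine_frame_carrier assms(2,3)] assms(4) by simp
qed

lemma curvature_top_deriv:
  fixes \<gamma> :: "real \<Rightarrow> real vec"
  assumes "n \<ge> 1" "central_affine_curvature n \<gamma> u" "k < n"
  shows "(deriv ^^ n) (\<lambda>t. \<gamma> t $ k) x =
    (\<Sum>i<n. u x $$ (i, n - 1) * (deriv ^^ i) (\<lambda>t. \<gamma> t $ k) x)"
proof -
  obtain m where n: "n = Suc m"
    using assms(1) by (cases n) auto
  have u: "u x \<in> V_space n" and "curve_deriv n n \<gamma> x =
      vec n (\<lambda>k. \<Sum>i=1..n-1. u x $$ (i - 1, n - 1) * curve_deriv n (i - 1) \<gamma> x $ k)"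
    using assms(2) by (auto simp: central_affine_curvature_def)
  then have "curve_deriv n n \<gamma> x $ k =
      (\<Sum>i=1..n-1. u x $$ (i - 1, n - 1) * curve_deriv n (i - 1) \<gamma> x $ k)"
    using assms(3) by simp
  then have "(deriv ^^ n) (\<lambda>t. \<gamma> t $ k) x =
      (\<Sum>i=Suc 0..m. u x $$ (i - 1, n - 1) * (deriv ^^ (i - 1)) (\<lambda>t. \<gamma> t $ k) x)"
    using assms(3) n by (simp add: curve_deriv_def del: funpow.simps)
  also have "\<dots> = (\<Sum>i<m. u x $$ (i, n - 1) * (deriv ^^ i) (\<lambda>t. \<gamma> t $ k) x)"
    by (subst sum.atLeast1_atMost_eq) simp
  \<comment> \<open>The added summand \<open>i = n - 1\<close> is 0, because the lower right corner
    of \<open>u x\<close> is 0.\<close>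
  also have "\<dots> = (\<Sum>i<n. u x $$ (i, n - 1) * (deriv ^^ i) (\<lambda>t. \<gamma> t $ k) x)"
    using u n by (auto simp: V_space_iff)
  finally show ?thesis .
qed

text \<open>Cramer's rule gives each curvature coefficient as the determinant of the frame with one
  column replaced by the \<open>n\<close>-th derivative of \<open>\<gamma>\<close>, hence as a
  polynomial in derivatives of \<open>\<gamma>\<close>.\<close>

lemma smooth_curvature:
  fixes \<gamma> :: "real \<Rightarrow> real vec"
  assumes "n \<ge> 1" "\<gamma> \<in> central_affine_curves n" "central_affine_curvature n \<gamma> u"
  shows "smooth_mat n u"
proof -
  have V: "u x \<in> V_space n" for x
    using assms(3) by (simp add: central_affine_curvature_def)
  have \<gamma>: "\<And>k. k < n \<Longrightarrow> smooth_fun (\<lambda>x. \<gamma> x $ k)" "det (affine_frame n \<gamma> x) = 1" for x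
    using assms(2) by (auto simp: central_affine_curves_def smooth_curve_def affine_frame_def)
  have last_col: "smooth_fun (\<lambda>x. u x $$ (i, n - 1))" if "i < n" for i
  proof -
    let ?A = "\<lambda>x. mat_of_cols n (map (\<lambda>j. if j = i then curve_deriv n n \<gamma> x
      else curve_deriv n j \<gamma> x) [0..<n])"
    have "det (?A x) = vec n (\<lambda>j. u x $$ (j, n - 1)) $ i" for x
      using that \<gamma>(2) curvature_top_deriv[OF assms(1,3)]
      by (intro det_affine_frame_replace) (auto simp: curve_deriv_def)
    then have "(\<lambda>x. u x $$ (i, n - 1)) = (\<lambda>x. det (?A x))"
      using that by simp
    moreover have "smooth_fun (\<lambda>x. det (?A x))"
    proof (rule smooth_fun_det)
      fix k j
      assume "k < n" "j < n"
      then have "(\<lambda>x. ?A x $$ (k, j)) = (deriv ^^ (if j = i then n else j)) (\<lambda>t. \<gamma> t $ k)"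
        by (auto simp: mat_of_cols_index curve_deriv_def)
      with \<gamma>(1)[OF \<open>k < n\<close>] show "smooth_fun (\<lambda>x. ?A x $$ (k, j))"
        by (simp add: smooth_fun_higher_deriv)
    qed auto
    ultimately show ?thesis
      by simp
  qed
  show ?thesis
    unfolding smooth_mat_def
  proof (intro conjI allI impI)
    show "u x \<in> carrier_mat n n" for x
      using V[of x] by (simp add: V_space_iff)
    fix i j
    assume "i < n" "j < n"
    show "smooth_fun (\<lambda>x. u x $$ (i, j))"
    proof (cases "j = n - 1")
      case True
      with last_col \<open>i < n\<close> show ?thesis
        by simp
    next
      case False
      then have "(\<lambda>x. u x $$ (i, j)) = (\<lambda>x. 0)"
        using V \<open>i < n\<close> \<open>j < n\<close> by (auto simp: V_space_iff)
      then show ?thesis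
        by simp
    qed
  qed
qed

text \<open>By the product rule, differentiating raises the order of each frame vector by one. The
  top one leaves the frame and is brought back by the curvature; collecting coefficients gives the
  recursion of \<open>jet_coeff\<close>.\<close>

lemma higher_deriv_frame_combination:
  fixes \<gamma> :: "real \<Rightarrow> real vec"
  assumes "n \<ge> 1" "central_affine_curvature n \<gamma> u" "smooth_mat n u"
    and "\<And>i. i < n \<Longrightarrow> smooth_fun (\<xi> i)" and "k < n" and "smooth_fun (\<lambda>t. \<gamma> t $ k)"
  shows "(deriv ^^ m) (\<lambda>x. \<Sum>i<n. \<xi> i x * (deriv ^^ i) (\<lambda>t. \<gamma> t $ k) x) =
    (\<lambda>x. \<Sum>i<n. jet_coeff n (phi_args n u \<xi>) m i x * (deriv ^^ i) (\<lambda>t. \<gamma> t $ k) x)"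
proof (induction m)
  case (Suc m)
  let ?J = "jet_coeff n (phi_args n u \<xi>)"
  define D where "D i = (deriv ^^ i) (\<lambda>t. \<gamma> t $ k)" for i
  have smooth_D: "smooth_fun (D i)" for i
    unfolding D_def using assms(6) by (rule smooth_fun_higher_deriv)
  have deriv_D: "deriv (D i) = D (Suc i)" for i
    by (simp add: D_def)
  have smooth_J: "smooth_fun (?J m i)" if "i < n" for i
    using that assms(3,4) by (intro smooth_fun_jet_coeff) (auto simp: smooth_mat_def)
  have "deriv (\<lambda>x. \<Sum>i<n. ?J m i x * D i x) x = (\<Sum>i<n. ?J (Suc m) i x * D i x)" for x
  proof -
    obtain p where n: "n = Suc p"
      using assms(1) by (cases n) auto
    have V: "u x \<in> V_space n"
      using assms(2) by (simp add: central_affine_curvature_def)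
    have "((\<lambda>x. \<Sum>i<n. ?J m i x * D i x) has_real_derivative
        (\<Sum>i<n. deriv (?J m i) x * D i x + deriv (D i) x * ?J m i x)) (at x)"
      using smooth_J smooth_D by (intro DERIV_sum DERIV_mult smooth_fun_DERIV) auto
    then have "deriv (\<lambda>x. \<Sum>i<n. ?J m i x * D i x) x =
        (\<Sum>i<n. deriv (?J m i) x * D i x) + (\<Sum>i<n. ?J m i x * D (Suc i) x)"
      by (simp add: DERIV_imp_deriv deriv_D sum.distrib mult.commute)
    also have "(\<Sum>i<n. ?J m i x * D (Suc i) x) =
        (\<Sum>i<p. ?J m i x * D (Suc i) x) + ?J m (n - 1) x * D n x"
      by (simp add: n)
    also have "(\<Sum>i<p. ?J m i x * D (Suc i) x) =
        (\<Sum>i<n. (if i = 0 then 0 else ?J m (i - 1) x) * D i x)"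
      unfolding n by (subst sum.lessThan_Suc_shift) simp
    also have "D n x = (\<Sum>i<n. u x $$ (i, n - 1) * D i x)"
      unfolding D_def by (rule curvature_top_deriv[OF assms(1,2,5)])
    finally have "deriv (\<lambda>x. \<Sum>i<n. ?J m i x * D i x) x =
        (\<Sum>i<n. (deriv (?J m i) x + (if i = 0 then 0 else ?J m (i - 1) x)
          + u x $$ (i, n - 1) * ?J m (n - 1) x) * D i x)"
      by (simp add: sum.distrib sum_distrib_left algebra_simps)
    also have "\<dots> = (\<Sum>i<n. ?J (Suc m) i x * D i x)"
      using jet_coeff_phi_args_Suc[of u, OF V] by (intro sum.cong refl) (simp del: jet_coeff.simps)
    finally show ?thesis .
  qed
  with Suc show ?case
    by (intro ext) (simp add: D_def[symmetric] del: jet_coeff.simps)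
qed simp

text \<open>The \<open>i\<close>-th determinant has the \<open>i\<close>-th derivative of the field
  in column \<open>i\<close>, so Cramer's rule returns its coordinate \<open>i\<close>, a diagonal
  entry of \<open>C\<close>.\<close>

lemma tangent_at_iff_jet_trace:
  fixes \<gamma> :: "real \<Rightarrow> real vec"
  assumes "n \<ge> 1" "\<gamma> \<in> central_affine_curves n" "central_affine_curvature n \<gamma> u"
    and "\<And>i. i < n \<Longrightarrow> smooth_fun (\<xi> i)"
  shows "tangent_at n \<gamma> (\<lambda>x. vec n (\<lambda>k. \<Sum>i<n. \<xi> i x * curve_deriv n i \<gamma> x $ k)) \<longleftrightarrow>
    (\<forall>x. jet_trace n (phi_args n u \<xi>) x = 0)"
proof -
  let ?X = "\<lambda>x. vec n (\<lambda>k. \<Sum>i<n. \<xi> i x * curve_deriv n i \<gamma> x $ k)"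
  let ?J = "jet_coeff n (phi_args n u \<xi>)"
  have \<gamma>: "\<And>k. k < n \<Longrightarrow> smooth_fun (\<lambda>x. \<gamma> x $ k)" "det (affine_frame n \<gamma> x) = 1" for x
    using assms(2) by (auto simp: central_affine_curves_def smooth_curve_def affine_frame_def)
  have X_index: "(\<lambda>x. ?X x $ k) = (\<lambda>x. \<Sum>i<n. \<xi> i x * (deriv ^^ i) (\<lambda>t. \<gamma> t $ k) x)"
    if "k < n" for k
    using that by (simp add: curve_deriv_def)
  have "smooth_curve n ?X"
    unfolding smooth_curve_def
  proof (intro conjI allI impI)
    fix k
    assume "k < n"
    then show "smooth_fun (\<lambda>x. ?X x $ k)"
      unfolding X_index[OF \<open>k < n\<close>] using assms(4) \<gamma>(1)
      by (intro smooth_fun_sum smooth_fun_mult smooth_fun_higher_deriv) auto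
  qed simp
  moreover have "det (mat_of_cols n (map (\<lambda>j. if j = i then curve_deriv n i ?X x
      else curve_deriv n j \<gamma> x) [0..<n])) = ?J i i x" if "i < n" for i x
  proof -
    have "curve_deriv n i ?X x $ k = (\<Sum>j<n. ?J i j x * (deriv ^^ j) (\<lambda>t. \<gamma> t $ k) x)"
      if "k < n" for k
    proof -
      have "curve_deriv n i ?X x $ k = (deriv ^^ i) (\<lambda>x. ?X x $ k) x"
        using that by (simp add: curve_deriv_def)
      also have "\<dots> = (\<Sum>j<n. ?J i j x * (deriv ^^ j) (\<lambda>t. \<gamma> t $ k) x)"
        unfolding X_index[OF that]
        by (subst higher_deriv_frame_combination[OF assms(1,3) smooth_curvature[OF assms(1-3)]])
          (use assms(4) that \<gamma>(1) in auto)
      finally show ?thesis .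
    qed
    then have "det (mat_of_cols n (map (\<lambda>j. if j = i then curve_deriv n i ?X x
        else curve_deriv n j \<gamma> x) [0..<n])) = vec n (\<lambda>j. ?J i j x) $ i"
      using that \<gamma>(2) by (intro det_affine_frame_replace) (auto simp: curve_deriv_def)
    then show ?thesis
      using that by simp
  qed
  ultimately show ?thesis
    unfolding tangent_at_def jet_trace_def by simp
qed

theorem corollary2p10:
  fixes n :: nat
    and \<gamma> :: "real \<Rightarrow> real vec"
    and u :: "real \<Rightarrow> real mat"
    and \<xi> :: "nat \<Rightarrow> real \<Rightarrow> real"
  assumes "n \<ge> 2"
    and "\<gamma> \<in> central_affine_curves n"
    and "central_affine_curvature n \<gamma> u"
    and "\<And>i. i < n \<Longrightarrow> smooth_fun (\<xi> i)"
  shows "tangent_at n \<gamma> (\<lambda>x. vec n (\<lambda>k. \<Sum>i<n. \<xi> i x * curve_deriv n i \<gamma> x $ k))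
         \<longleftrightarrow> \<xi> 0 = diff_poly_eval (phi n) (phi_args n u \<xi>)"
proof -
  have n: "n \<ge> 1"
    using assms(1) by simp
  \<comment> \<open>Existence ensures that the choice in \<open>phi\<close> has the defining
    property; the equivalence valid for every such polynomial then applies to it.\<close>
  have "is_phi n (phi n)"
    unfolding phi_def using is_phi_exists[OF n] by (rule someI_ex)
  moreover have "u x \<in> V_space n" for x
    using assms(3) by (simp add: central_affine_curvature_def)
  ultimately show ?thesis
    using tangent_at_iff_jet_trace[OF n assms(2-4)] smooth_curvature[OF n assms(2,3)] assms(4)
    by (simp add: is_phi_iff_jet_trace_zero[OF n])
qed

end
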